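(* For all $j\in\mathbb Z$ and all integers $k\ge 0$, $$T_{1,j,k}=T_{1,j+k,0}\;\mathcal Z^{0,0}_{j-k,\,j+k},$$ where $\mathcal Z^{0,0}_{j-k,j+k}$ is the partition function of weighted paths on the graph $\widetilde G_r$ that start at the vertex $0$ at time $j-k$ and end at the vertex $0$ at time $j+k$.
   Context: $T$-system: fix $r\ge1$, $I_r=\{1,\dots,r\}$. Let $\{T_{\alpha,j,0},T_{\alpha,j,1}:\alpha\in I_r,\ j\in\mathbb Z\}$ be independent commuting variables and let $T_{\alpha,j,k}$ ($0\le\alpha\le r+1$, $j,k\in\mathbb Z$) be the family of nonzero elements of the field of rational functions in these variables determined by $T_{\alpha,j,k+1}T_{\alpha,j,k-1}=T_{\alpha,j+1,k}T_{\alpha,j-1,k}+T_{\alpha+1,j,k}T_{\alpha-1,j,k}$ for $\alpha\in I_r$, and $T_{0,j,k}=T_{r+1,j,k}=1$. Weights: for $t\in\mathbb Z$ put $y_1(t)=\dfrac{T_{1,t,1}}{T_{1,t+1,0}}$ and, for $1\le\alpha\le r$, $$y_{2\alpha+1}(t)=\frac{T_{\alpha+1,t-1,1}\,T_{\alpha,t+1,0}}{T_{\alpha+1,t,0}\,T_{\alpha,t,1}},\qquad y_{2\alpha}(t)=\frac{T_{\alpha+1,t,1}\,T_{\alpha-1,t+1,0}}{T_{\alpha,t,0}\,T_{\alpha,t+1,1}} .$$ Graph: $\widetilde G_r$ has spine vertices $0,1,\dots,r+2$ and side vertices $2',3',\dots,r'$; its (unoriented) edges are $m - (m+1)$ for $0\le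 m\le r+1$ and $m - m'$ for $2\le m\le r$. Paths: a path from $(t_1,a)$ to $(t_2,b)$ is a sequence of vertices $p(t_1)=a,p(t_1+1),\dots,p(t_2)=b$ with consecutive vertices adjacent. A step $a\to b$ taken from time $s$ to time $s+1$ has weight $w_{a,b}(s)$, where $w_{m,m+1}(s)=1$ ($0\le m\le r+1$), $w_{m,m'}(s)=1$ ($2\le m\le r$), $w_{1,0}(s)=y_1(s)$, $w_{m+1,m}(s)=y_{2m}(s)$ ($1\le m\le r$), $w_{m',m}(s)=y_{2m-1}(s)$ ($2\le m\le r$), $w_{r+2,r+1}(s)=y_{2r+1}(s)$. The weight of a path is $\prod_{s=t_1}^{t_2-1}w_{p(s),p(s+1)}(s)$, and $\mathcal Z^{a,b}_{t_1,t_2}$ is the sum of the weights of all such paths (equal to $\delta_{a,b}$ if $t_1=t_2$). *)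

theory Defs
  imports
    Complex_Main
    "HOL-Library.FuncSet"
    "HOL-Library.Poly_Mapping"
    "HOL-Library.Product_Lexorder"
    "HOL-Computational_Algebra.Fraction_Field"
begin

text \<open>
  The field of rational functions over \<open>'k\<close> in the commuting variables \<open>X\<^bsub>\<alpha>,j,k\<^esub>\<close>.
  Polynomials are finitely supported maps from monomials to coefficients. The lexicographic order on
  the index type serves only to obtain the integral domain instance. The field has
  variables for all indices, but only those with \<open>\<alpha> \<in> I\<^sub>r\<close> and \<open>k \<in> {0, 1}\<close> are ever used.
\<close>

type_synonym idx = "nat \<times> int \<times> int"
type_synonym 'k ratfun = "((idx \<Rightarrow>\<^sub>0 nat) \<Rightarrow>\<^sub>0 'k) fract"

definition X :: "nat \<Rightarrow> int \<Rightarrow> int \<Rightarrow> 'k::field_char_0 ratfun" where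
  "X \<alpha> j k = Fract (Poly_Mapping.single (Poly_Mapping.single (\<alpha>, j, k) 1) 1) 1"


section \<open>The T-system\<close>

definition T_system :: "nat \<Rightarrow> (nat \<Rightarrow> int \<Rightarrow> int \<Rightarrow> 'k::field_char_0 ratfun) \<Rightarrow> bool" where
  "T_system r T \<longleftrightarrow>
     (\<forall>\<alpha>\<in>{1..r}. \<forall>j. \<forall>k\<in>{0, 1}. T \<alpha> j k = X \<alpha> j k) \<and>
     (\<forall>\<alpha>\<in>{0..r + 1}. \<forall>j k. T \<alpha> j k \<noteq> 0) \<and>
     (\<forall>\<alpha>\<in>{1..r}. \<forall>j k. T \<alpha> j (k + 1) * T \<alpha> j (k - 1) =
        T \<alpha> (j + 1) k * T \<alpha> (j - 1) k + T (\<alpha> + 1) j k * T (\<alpha> - 1) j k) \<and>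
     (\<forall>j k. T 0 j k = 1 \<and> T (r + 1) j k = 1)"

text \<open>
  A family with this property exists and is unique on the range \<open>0 \<le> \<alpha> \<le> r + 1\<close>. For existence, the
  only issue is that no division by zero occurs; this holds because everything stays in the set of
  quotients of nonzero polynomials with natural number coefficients.
\<close>

definition nat_poly :: "((idx \<Rightarrow>\<^sub>0 nat) \<Rightarrow>\<^sub>0 'k::field_char_0) set" where
  "nat_poly = {p. p \<noteq> 0 \<and> (\<forall>m. Poly_Mapping.lookup p m \<in> \<nat>)}"

definition pos_ratfun :: "'k::field_char_0 ratfun set" where
  "pos_ratfun = {Fract p q | p q. p \<in> nat_poly \<and> q \<in> nat_poly}"

lemma Sum_any_in_Nats:
  assumes "\<And>x. f x \<in> \<nat>"
  shows "Sum_any f \<in> (\<nat> :: 'a::semiring_1 set)"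
proof -
  have "sum f A \<in> \<nat>" for A
    using assms by (induction A rule: infinite_finite_induct) auto
  then show ?thesis by (simp add: Sum_any.expand_set)
qed

lemma Nats_add_eq_0:
  assumes "x \<in> (\<nat> :: 'a::semiring_char_0 set)" "y \<in> \<nat>" "x + y = 0"
  shows "x = 0"
proof -
  obtain m n :: nat where "x = of_nat m" "y = of_nat n"
    using assms(1,2) by (auto elim!: Nats_cases)
  with assms(3) show ?thesis by (simp flip: of_nat_add)
qed

lemma nat_poly_add: "p \<in> nat_poly \<Longrightarrow> q \<in> nat_poly \<Longrightarrow> p + q \<in> nat_poly"
proof -
  assume p: "p \<in> nat_poly" and q: "q \<in> nat_poly"
  have "p + q \<noteq> 0"
  proof
    assume eq: "p + q = 0"
    have "Poly_Mapping.lookup p m = 0" for m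
    proof (rule Nats_add_eq_0)
      show "Poly_Mapping.lookup p m + Poly_Mapping.lookup q m = 0"
        using eq by (metis lookup_add lookup_zero)
    qed (use p q in \<open>auto simp: nat_poly_def\<close>)
    then show False using p by (auto simp: nat_poly_def poly_mapping_eq_iff fun_eq_iff)
  qed
  then show ?thesis using p q by (auto simp: nat_poly_def lookup_add)
qed

lemma nat_poly_mult: "p \<in> nat_poly \<Longrightarrow> q \<in> nat_poly \<Longrightarrow> p * q \<in> nat_poly"
  unfolding nat_poly_def
  by (auto simp: lookup_mult when_def intro!: Sum_any_in_Nats Nats_mult)

lemma nat_poly_1: "1 \<in> nat_poly"
  by (auto simp: nat_poly_def lookup_one when_def)

lemma pos_ratfun_nonzero: "x \<in> pos_ratfun \<Longrightarrow> x \<noteq> 0"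
  by (auto simp: pos_ratfun_def nat_poly_def eq_fract Zero_fract_def)

lemma pos_ratfun_add: "x \<in> pos_ratfun \<Longrightarrow> y \<in> pos_ratfun \<Longrightarrow> x + y \<in> pos_ratfun"
proof -
  assume "x \<in> pos_ratfun" "y \<in> pos_ratfun"
  then obtain p q p' q' where *: "x = Fract p q" "y = Fract p' q'"
    "p \<in> nat_poly" "q \<in> nat_poly" "p' \<in> nat_poly" "q' \<in> nat_poly"
    by (auto simp: pos_ratfun_def)
  then have "x + y = Fract (p * q' + p' * q) (q * q')"
    by (simp add: nat_poly_def)
  with * show ?thesis
    unfolding pos_ratfun_def by (blast intro: nat_poly_add nat_poly_mult)
qed

lemma pos_ratfun_mult: "x \<in> pos_ratfun \<Longrightarrow> y \<in> pos_ratfun \<Longrightarrow> x * y \<in> pos_ratfun"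
  by (fastforce simp: pos_ratfun_def intro: nat_poly_mult)

lemma pos_ratfun_divide: "x \<in> pos_ratfun \<Longrightarrow> y \<in> pos_ratfun \<Longrightarrow> x / y \<in> pos_ratfun"
  by (fastforce simp: pos_ratfun_def intro: nat_poly_mult)

lemma pos_ratfun_1: "1 \<in> pos_ratfun"
  unfolding pos_ratfun_def One_fract_def using nat_poly_1 by blast

lemma pos_ratfun_X: "X \<alpha> j k \<in> pos_ratfun"
proof -
  have "Poly_Mapping.single (Poly_Mapping.single (\<alpha>, j, k) 1) 1 \<in> nat_poly"
    by (auto simp: nat_poly_def lookup_single when_def dest: arg_cong[of _ 0 Poly_Mapping.keys])
  then show ?thesis unfolding pos_ratfun_def X_def using nat_poly_1 by blast
qed

fun T_layer :: "nat \<Rightarrow> (nat \<Rightarrow> int \<Rightarrow> 'a::field) \<Rightarrow> (nat \<Rightarrow> int \<Rightarrow> 'a) \<Rightarrow> nat \<Rightarrow> nat \<Rightarrow> int \<Rightarrow> 'a" where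
  "T_layer r A B 0 \<alpha> j = A \<alpha> j"
| "T_layer r A B (Suc 0) \<alpha> j = B \<alpha> j"
| "T_layer r A B (Suc (Suc n)) \<alpha> j =
     (if \<alpha> \<in> {1..r} then
        (T_layer r A B (Suc n) \<alpha> (j + 1) * T_layer r A B (Suc n) \<alpha> (j - 1) +
         T_layer r A B (Suc n) (\<alpha> + 1) j * T_layer r A B (Suc n) (\<alpha> - 1) j) / T_layer r A B n \<alpha> j
      else 1)"

lemma T_layer_pos:
  assumes "\<And>\<alpha> j. A \<alpha> j \<in> pos_ratfun" "\<And>\<alpha> j. B \<alpha> j \<in> pos_ratfun"
  shows "T_layer r A B n \<alpha> j \<in> pos_ratfun"
  using assms
  by (induction r A B n \<alpha> j rule: T_layer.induct)
    (auto intro!: pos_ratfun_add pos_ratfun_mult pos_ratfun_divide pos_ratfun_1)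

lemma T_system_exists: "\<exists>T :: nat \<Rightarrow> int \<Rightarrow> int \<Rightarrow> 'k::field_char_0 ratfun. T_system r T"
proof -
  define I where "I k \<alpha> j = (if \<alpha> \<in> {1..r} then X \<alpha> j k else 1 :: 'k ratfun)" for k \<alpha> j
  define T where "T \<alpha> j k = (if k \<ge> 0 then T_layer r (I 0) (I 1) (nat k) \<alpha> j
                                else T_layer r (I 1) (I 0) (nat (1 - k)) \<alpha> j)" for \<alpha> j k
  have I_pos: "I k \<alpha> j \<in> pos_ratfun" for k \<alpha> j
    by (simp add: I_def pos_ratfun_X pos_ratfun_1)
  have nz: "T_layer r (I k) (I k') n \<alpha> j \<noteq> 0" for k k' n \<alpha> j
    by (intro pos_ratfun_nonzero T_layer_pos I_pos)
  have T_up: "T \<alpha> j k = T_layer r (I 0) (I 1) (nat k) \<alpha> j" if "k \<ge> 0" for \<alpha> j k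
    using that by (simp add: T_def)
  have T_down: "T \<alpha> j k = T_layer r (I 1) (I 0) (nat (1 - k)) \<alpha> j" if le: "k \<le> 1" for \<alpha> j k
  proof -
    consider "k = 0" | "k = 1" | "k < 0" using le by linarith
    then show ?thesis by cases (simp_all add: T_def)
  qed
  have layer_out: "T_layer r (I k) (I k') n \<alpha> j = 1" if "\<alpha> \<notin> {1..r}" for k k' n \<alpha> j
    using that by (cases "(r, I k, I k', n, \<alpha>, j)" rule: T_layer.cases) (auto simp: I_def)
  have step: "T \<alpha> j (k + 1) * T \<alpha> j (k - 1) =
      T \<alpha> (j + 1) k * T \<alpha> (j - 1) k + T (\<alpha> + 1) j k * T (\<alpha> - 1) j k"
    if \<alpha>: "\<alpha> \<in> {1..r}" for \<alpha> j k
  proof (cases "k \<ge> 1")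
    case True
    define n where "n = nat (k - 1)"
    have k: "nat k = Suc n" "nat (k + 1) = Suc (Suc n)" "nat (k - 1) = n"
      using True by (auto simp: n_def)
    show ?thesis using True \<alpha> nz by (simp add: T_up k)
  next
    case False
    define n where "n = nat (- k)"
    have k: "nat (1 - k) = Suc n" "nat (1 - (k - 1)) = Suc (Suc n)" "nat (1 - (k + 1)) = n"
      using False by (auto simp: n_def)
    have "T \<alpha> j (k - 1) * T \<alpha> j (k + 1) =
      T \<alpha> (j + 1) k * T \<alpha> (j - 1) k + T (\<alpha> + 1) j k * T (\<alpha> - 1) j k"
      using False \<alpha> nz by (simp only: T_down k) (simp add: T_down k)
    then show ?thesis by (simp add: mult.commute)
  qed
  have "T_system r T"
    unfolding T_system_def using step nz layer_out
    by (auto simp: T_def I_def)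
  then show ?thesis by blast
qed

lemma T_system_unique:
  assumes "T_system r T" "T_system r T'" "\<alpha> \<in> {0..r + 1}"
  shows "T \<alpha> j k = T' \<alpha> j k"
proof -
  have eqn: "S \<alpha> j (k + 1) * S \<alpha> j (k - 1) =
        S \<alpha> (j + 1) k * S \<alpha> (j - 1) k + S (\<alpha> + 1) j k * S (\<alpha> - 1) j k"
    if "S = T \<or> S = T'" "\<alpha> \<in> {1..r}" for S \<alpha> j k
    using that assms(1,2) unfolding T_system_def by blast
  have nz: "S \<alpha> j k \<noteq> 0" if "S = T \<or> S = T'" "\<alpha> \<in> {0..r + 1}" for S \<alpha> j k
    using that assms(1,2) unfolding T_system_def by blast
  have init: "T \<alpha> j k = T' \<alpha> j k" if "\<alpha> \<in> {0..r + 1}" "k = 0 \<or> k = 1 \<or> \<alpha> = 0 \<or> \<alpha> = r + 1" for \<alpha> j k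
  proof (cases "\<alpha> \<in> {1..r}")
    case True
    with that(2) have "k \<in> {0, 1}" by auto
    with True assms(1,2) show ?thesis unfolding T_system_def by metis
  next
    case False
    with that(1) have "\<alpha> = 0 \<or> \<alpha> = r + 1" by auto
    with assms(1,2) show ?thesis unfolding T_system_def by metis
  qed
  have up: "\<forall>\<alpha>\<in>{0..r + 1}. \<forall>j. T \<alpha> j (int n) = T' \<alpha> j (int n) \<and> T \<alpha> j (int n + 1) = T' \<alpha> j (int n + 1)" for n
  proof (induction n)
    case 0
    then show ?case using init by simp
  next
    case (Suc n)
    have "T \<alpha> j (int n + 1 + 1) = T' \<alpha> j (int n + 1 + 1)" if a: "\<alpha> \<in> {0..r + 1}" for \<alpha> j
    proof (cases "\<alpha> \<in> {1..r}")
      case True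
      then have "\<alpha> - 1 \<in> {0..r + 1}" "\<alpha> + 1 \<in> {0..r + 1}" by auto
      then have "T \<alpha> j (int n + 1 + 1) * T \<alpha> j (int n) = T' \<alpha> j (int n + 1 + 1) * T' \<alpha> j (int n)"
        using eqn[of T \<alpha> j "int n + 1"] eqn[of T' \<alpha> j "int n + 1"] True Suc by simp
      then show ?thesis using Suc nz[of T \<alpha> j "int n"] a by simp
    next
      case False
      then show ?thesis using a by (intro init) auto
    qed
    with Suc show ?case by (simp add: add.commute)
  qed
  have down: "\<forall>\<alpha>\<in>{0..r + 1}. \<forall>j. T \<alpha> j (- int n) = T' \<alpha> j (- int n) \<and> T \<alpha> j (1 - int n) = T' \<alpha> j (1 - int n)" for n
  proof (induction n)
    case 0
    then show ?case using init by simp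
  next
    case (Suc n)
    have "T \<alpha> j (- int n - 1) = T' \<alpha> j (- int n - 1)" if a: "\<alpha> \<in> {0..r + 1}" for \<alpha> j
    proof (cases "\<alpha> \<in> {1..r}")
      case True
      then have "\<alpha> - 1 \<in> {0..r + 1}" "\<alpha> + 1 \<in> {0..r + 1}" by auto
      then have "T \<alpha> j (1 - int n) * T \<alpha> j (- int n - 1) = T' \<alpha> j (1 - int n) * T' \<alpha> j (- int n - 1)"
        using eqn[of T \<alpha> j "- int n"] eqn[of T' \<alpha> j "- int n"] True Suc by simp
      then show ?thesis using Suc nz[of T \<alpha> j "1 - int n"] a by simp
    next
      case False
      then show ?thesis using a by (intro init) auto
    qed
    moreover have "- int (Suc n) = - int n - 1" "1 - int (Suc n) = - int n" by simp_all
    ultimately show ?case using Suc by metis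
  qed
  show ?thesis
    using up[of "nat k"] down[of "nat (- k)"] assms(3) by (cases "k \<ge> 0") auto
qed


section \<open>The weighted graph\<close>

text \<open>The side vertex \<open>m'\<close> is \<open>Side m\<close>.\<close>

datatype vertex = Spine nat | Side nat

definition G_verts :: "nat \<Rightarrow> vertex set" where
  "G_verts r = Spine ` {0..r + 2} \<union> Side ` {2..r}"

definition G_edges :: "nat \<Rightarrow> vertex set set" where
  "G_edges r = {{Spine m, Spine (m + 1)} | m. m \<in> {0..r + 1}} \<union> {{Spine m, Side m} | m. m \<in> {2..r}}"

text \<open>The weights \<open>y\<^sub>i(t)\<close>, used for \<open>1 \<le> i \<le> 2r + 1\<close>, with \<open>\<alpha> = i div 2\<close> for \<open>i > 1\<close>.\<close>

definition y :: "(nat \<Rightarrow> int \<Rightarrow> int \<Rightarrow> 'a::field) \<Rightarrow> nat \<Rightarrow> int \<Rightarrow> 'a" where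
  "y T i t =
     (if i = 1 then T 1 t 1 / T 1 (t + 1) 0
      else let \<alpha> = i div 2 in
        if odd i then (T (\<alpha> + 1) (t - 1) 1 * T \<alpha> (t + 1) 0) / (T (\<alpha> + 1) t 0 * T \<alpha> t 1)
        else (T (\<alpha> + 1) t 1 * T (\<alpha> - 1) (t + 1) 0) / (T \<alpha> t 0 * T \<alpha> (t + 1) 1))"

text \<open>Only the values on pairs of adjacent vertices matter; on other pairs the value is junk.\<close>

fun step_weight :: "nat \<Rightarrow> (nat \<Rightarrow> int \<Rightarrow> int \<Rightarrow> 'a::field) \<Rightarrow> vertex \<Rightarrow> vertex \<Rightarrow> int \<Rightarrow> 'a" where
  "step_weight r T (Spine m) (Spine n) s =
     (if n = m + 1 then 1
      else if n = 0 then y T 1 s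
      else if n \<le> r then y T (2 * n) s
      else y T (2 * r + 1) s)"
| "step_weight r T (Spine m) (Side n) s = 1"
| "step_weight r T (Side m) (Spine n) s = y T (2 * n - 1) s"
| "step_weight r T (Side m) (Side n) s = 0"

text \<open>
  Paths from \<open>(t\<^sub>1, a)\<close> to \<open>(t\<^sub>2, b)\<close> for \<open>t\<^sub>1 \<le> t\<^sub>2\<close>. Extensionality makes a path determined by its
  vertices \<open>p(t\<^sub>1), \<dots>, p(t\<^sub>2)\<close>, so that each path is counted once in the sum below.
\<close>

definition paths :: "nat \<Rightarrow> int \<Rightarrow> int \<Rightarrow> vertex \<Rightarrow> vertex \<Rightarrow> (int \<Rightarrow> vertex) set" where
  "paths r t1 t2 a b =
     {p \<in> {t1..t2} \<rightarrow>\<^sub>E G_verts r. p t1 = a \<and> p t2 = b \<and> (\<forall>s\<in>{t1..<t2}. {p s, p (s + 1)} \<in> G_edges r)}"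

definition path_weight :: "nat \<Rightarrow> (nat \<Rightarrow> int \<Rightarrow> int \<Rightarrow> 'a::field) \<Rightarrow> int \<Rightarrow> int \<Rightarrow> (int \<Rightarrow> vertex) \<Rightarrow> 'a" where
  "path_weight r T t1 t2 p = (\<Prod>s\<in>{t1..<t2}. step_weight r T (p s) (p (s + 1)) s)"

definition Z :: "nat \<Rightarrow> (nat \<Rightarrow> int \<Rightarrow> int \<Rightarrow> 'a::field) \<Rightarrow> int \<Rightarrow> int \<Rightarrow> vertex \<Rightarrow> vertex \<Rightarrow> 'a" where
  "Z r T t1 t2 a b = (\<Sum>p\<in>paths r t1 t2 a b. path_weight r T t1 t2 p)"

lemma finite_paths: "finite (paths r t1 t2 a b)"
proof (rule finite_subset)
  show "paths r t1 t2 a b \<subseteq> {t1..t2} \<rightarrow>\<^sub>E G_verts r" by (auto simp: paths_def)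
  show "finite ({t1..t2} \<rightarrow>\<^sub>E G_verts r)" by (intro finite_PiE) (auto simp: G_verts_def)
qed

lemma Z_same:
  assumes "a \<in> G_verts r"
  shows "Z r T t t a b = (if a = b then 1 else 0)"
proof -
  have "paths r t t a b = (if a = b then {\<lambda>s\<in>{t}. a} else {})"
    using assms by (auto simp: paths_def fun_eq_iff PiE_iff extensional_def)
  then show ?thesis by (simp add: Z_def path_weight_def)
qed

end

theory Submission
  imports Defs
begin

text \<open>
  Raising the level by one, \<open>T'\<^bsub>\<alpha>,j,k\<^esub> = T\<^bsub>\<alpha>,j,k+1\<^esub>\<close>, preserves the T-system relations, so by induction
  on \<open>k\<close> it suffices to show that, for the weights of \<open>T\<close>, the paths from \<open>1\<close> to \<open>1\<close> have the same
  partition function as the paths from \<open>0\<close> to \<open>0\<close> with the weights of \<open>T'\<close>. The transfer matrices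
  \<open>M(s)\<close> and \<open>M'(s)\<close> of the two weightings are intertwined: \<open>M(s) A(s+1) = A(s) M'(s)\<close> for an
  explicit local matrix \<open>A(s)\<close> whose row \<open>1\<close> is \<open>e\<^sub>0\<close> and whose column \<open>0\<close> is \<open>e\<^sub>1\<close>.
\<close>

section \<open>Decomposition of paths by the first step\<close>

definition nbrs :: "nat \<Rightarrow> vertex \<Rightarrow> vertex set" where
  "nbrs r a = {c. {a, c} \<in> G_edges r}"

lemma nbrs_subset_verts: "nbrs r a \<subseteq> G_verts r"
  by (auto simp: nbrs_def G_edges_def G_verts_def doubleton_eq_iff)

lemma finite_nbrs: "finite (nbrs r a)"
  by (rule finite_subset[OF nbrs_subset_verts]) (simp add: G_verts_def)

lemma int_interval_Cons:
  fixes s t :: int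
  assumes "s < t"
  shows "{s..<t} = insert s {s + 1..<t}" "{s..t} = insert s {s + 1..t}"
  using assms by auto

lemma paths_Cons:
  assumes "a \<in> G_verts r" "s < t" "c \<in> nbrs r a" "q \<in> paths r (s + 1) t c b"
  shows "q(s := a) \<in> paths r s t a b"
proof -
  have "{(q(s := a)) u, (q(s := a)) (u + 1)} \<in> G_edges r" if "u \<in> {s..<t}" for u
    using assms that by (cases "u = s") (auto simp: nbrs_def paths_def)
  moreover have "q(s := a) \<in> {s..t} \<rightarrow>\<^sub>E G_verts r"
    using assms by (auto simp: paths_def PiE_iff extensional_def)
  ultimately show ?thesis
    using assms by (auto simp: paths_def)
qed

lemma paths_tl:
  assumes "s < t" "p \<in> paths r s t a b"
  shows "p (s + 1) \<in> nbrs r a" "p(s := undefined) \<in> paths r (s + 1) t (p (s + 1)) b"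
proof -
  show "p (s + 1) \<in> nbrs r a"
    using assms by (auto simp: nbrs_def paths_def)
  have "p(s := undefined) \<in> {s + 1..t} \<rightarrow>\<^sub>E G_verts r"
    using assms by (auto simp: paths_def PiE_iff extensional_def)
  then show "p(s := undefined) \<in> paths r (s + 1) t (p (s + 1)) b"
    using assms by (auto simp: paths_def)
qed

lemma path_weight_Cons:
  assumes "s < t"
  shows "path_weight r T s t p =
    step_weight r T (p s) (p (s + 1)) s * path_weight r T (s + 1) t p"
  using assms by (simp add: path_weight_def int_interval_Cons)

lemma path_weight_fun_upd: "path_weight r T (s + 1) t (p(s := a)) = path_weight r T (s + 1) t p"
  unfolding path_weight_def by (intro prod.cong) auto

lemma Z_first_step:
  assumes "a \<in> G_verts r" "s < t"
  shows "Z r T s t a b = (\<Sum>c\<in>nbrs r a. step_weight r T a c s * Z r T (s + 1) t c b)"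
proof -
  have "Z r T s t a b = (\<Sum>(c, q)\<in>(SIGMA c:nbrs r a. paths r (s + 1) t c b).
      step_weight r T a c s * path_weight r T (s + 1) t q)"
    unfolding Z_def
  \<comment> \<open>Resetting the tail to \<open>undefined\<close> at \<open>s\<close> makes it
    extensional on the shorter interval, so cutting and prepending are mutually inverse.\<close>
  proof (rule sum.reindex_bij_witness
      [where i = "\<lambda>(c, q). q(s := a)" and j = "\<lambda>p. (p (s + 1), p(s := undefined))"])
    fix p assume p: "p \<in> paths r s t a b"
    then have "p s = a" by (simp add: paths_def)
    then show "(case (p (s + 1), p(s := undefined)) of (c, q) \<Rightarrow> q(s := a)) = p"
      by auto
    show "(p (s + 1), p(s := undefined)) \<in> (SIGMA c:nbrs r a. paths r (s + 1) t c b)"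
      using paths_tl[OF assms(2) p] by auto
    show "(case (p (s + 1), p(s := undefined)) of (c, q) \<Rightarrow>
        step_weight r T a c s * path_weight r T (s + 1) t q) = path_weight r T s t p"
      using assms(2) \<open>p s = a\<close> by (simp add: path_weight_fun_upd path_weight_Cons)
  next
    fix cq assume "cq \<in> (SIGMA c:nbrs r a. paths r (s + 1) t c b)"
    then obtain c q where cq: "cq = (c, q)" "c \<in> nbrs r a" "q \<in> paths r (s + 1) t c b"
      by auto
    then have "q (s + 1) = c" "q s = undefined"
      by (auto simp: paths_def PiE_iff extensional_def)
    then show "((case cq of (c, q) \<Rightarrow> q(s := a)) (s + 1),
        (case cq of (c, q) \<Rightarrow> q(s := a))(s := undefined)) = cq"
      using cq by auto
    show "(case cq of (c, q) \<Rightarrow> q(s := a)) \<in> paths r s t a b"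
      using cq paths_Cons[OF assms] by simp
  qed
  also have "\<dots> = (\<Sum>c\<in>nbrs r a. step_weight r T a c s * Z r T (s + 1) t c b)"
    unfolding Z_def sum_distrib_left
    by (rule sum.Sigma[symmetric]) (simp_all add: finite_nbrs finite_paths)
  finally show ?thesis .
qed

section \<open>Neighbours and the rows of the transfer matrix\<close>

text \<open>
  Both ends of the spine behave like side vertices; treating \<open>r + 2\<close> as the side vertex of \<open>r + 1\<close>
  makes the formulas below uniform.
\<close>

definition side :: "nat \<Rightarrow> nat \<Rightarrow> vertex" where
  "side r m = (if m = r + 1 then Spine (r + 2) else Side m)"

lemma nbrs_simps:
  "nbrs r (Spine 0) = {Spine 1}"
  "nbrs r (Spine 1) = {Spine 2, Spine 0}"
  "2 \<le> m \<Longrightarrow> m \<le> r \<Longrightarrow> nbrs r (Spine m) = {Spine (m + 1), side r m, Spine (m - 1)}"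
  "1 \<le> r \<Longrightarrow> nbrs r (Spine (r + 1)) = {side r (r + 1), Spine r}"
  "2 \<le> m \<Longrightarrow> m \<le> r + 1 \<Longrightarrow> nbrs r (side r m) = {Spine m}"
proof -
  show "nbrs r (Spine m) = {Spine (m + 1), side r m, Spine (m - 1)}" if "2 \<le> m" "m \<le> r"
  proof -
    obtain l where "m = Suc l" using \<open>2 \<le> m\<close> by (cases m) auto
    then show ?thesis
      using that by (auto simp: nbrs_def G_edges_def doubleton_eq_iff side_def)
  qed
qed (auto simp: nbrs_def G_edges_def doubleton_eq_iff side_def)

text \<open>With the index shifted by one, the side vertices and the end
  \<open>Spine (r + 2)\<close> share the odd weight formula, although \<open>step_weight\<close>
  treats them by different clauses.\<close>

lemma Z_step:
  assumes "s < t" "1 \<le> r"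
  shows "Z r T s t (Spine 0) b = Z r T (s + 1) t (Spine 1) b"
    and "Z r T s t (Spine 1) b =
      Z r T (s + 1) t (Spine 2) b + y T 1 s * Z r T (s + 1) t (Spine 0) b"
    and "1 \<le> m \<Longrightarrow> m < r \<Longrightarrow> Z r T s t (Spine (m + 1)) b =
      Z r T (s + 1) t (Spine (m + 2)) b + Z r T (s + 1) t (side r (m + 1)) b +
      y T (2 * m) s * Z r T (s + 1) t (Spine m) b"
    and "Z r T s t (Spine (r + 1)) b =
      Z r T (s + 1) t (side r (r + 1)) b + y T (2 * r) s * Z r T (s + 1) t (Spine r) b"
    and "1 \<le> m \<Longrightarrow> m \<le> r \<Longrightarrow> Z r T s t (side r (m + 1)) b =
      y T (2 * m + 1) s * Z r T (s + 1) t (Spine (m + 1)) b"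
proof -
  have mem: "Spine m \<in> G_verts r" if "m \<le> r + 2" for m
    using that by (auto simp: G_verts_def)
  have mem_side: "side r (m + 1) \<in> G_verts r" if "1 \<le> m" "m \<le> r" for m
    using that by (auto simp: G_verts_def side_def)
  show "Z r T s t (Spine 0) b = Z r T (s + 1) t (Spine 1) b"
    by (simp add: Z_first_step[OF mem assms(1)] nbrs_simps(1))
  show "Z r T s t (Spine 1) b =
      Z r T (s + 1) t (Spine 2) b + y T 1 s * Z r T (s + 1) t (Spine 0) b"
    using assms(2) by (simp add: Z_first_step[OF mem assms(1)] nbrs_simps(2)[simplified])
  show "Z r T s t (Spine (m + 1)) b =
      Z r T (s + 1) t (Spine (m + 2)) b + Z r T (s + 1) t (side r (m + 1)) b +
      y T (2 * m) s * Z r T (s + 1) t (Spine m) b" if "1 \<le> m" "m < r"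
    using that by (subst Z_first_step[OF mem assms(1)], simp, subst nbrs_simps(3))
      (auto simp: side_def add.assoc)
  show "Z r T s t (Spine (r + 1)) b =
      Z r T (s + 1) t (side r (r + 1)) b + y T (2 * r) s * Z r T (s + 1) t (Spine r) b"
    using assms(2) by (subst Z_first_step[OF mem assms(1)], simp, subst nbrs_simps(4))
      (auto simp: side_def)
  show "Z r T s t (side r (m + 1)) b =
      y T (2 * m + 1) s * Z r T (s + 1) t (Spine (m + 1)) b" if "1 \<le> m" "m \<le> r"
    using that by (subst Z_first_step[OF mem_side assms(1)], simp, simp, subst nbrs_simps(5))
      (auto simp: side_def)
qed


section \<open>The intertwining relation\<close>

text \<open>The prescription of levels 0 and 1 as variables is left out because raising destroys it;
  what remains is stable under raising, as the induction on the level requires.\<close>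

locale T_family =
  fixes r :: nat and T :: "nat \<Rightarrow> int \<Rightarrow> int \<Rightarrow> 'a::field"
  assumes r_pos: "1 \<le> r"
    and nonzero: "\<alpha> \<le> r + 1 \<Longrightarrow> T \<alpha> j k \<noteq> 0"
    and relation: "1 \<le> \<alpha> \<Longrightarrow> \<alpha> \<le> r \<Longrightarrow> T \<alpha> j (k + 1) * T \<alpha> j (k - 1) =
        T \<alpha> (j + 1) k * T \<alpha> (j - 1) k + T (\<alpha> + 1) j k * T (\<alpha> - 1) j k"
    and boundary: "T 0 j k = 1" "T (r + 1) j k = 1"
begin

definition raised :: "nat \<Rightarrow> int \<Rightarrow> int \<Rightarrow> 'a" where
  "raised \<alpha> j k = T \<alpha> j (k + 1)"

lemma raised_family: "T_family r raised"
proof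
  show "raised \<alpha> j (k + 1) * raised \<alpha> j (k - 1) =
      raised \<alpha> (j + 1) k * raised \<alpha> (j - 1) k + raised (\<alpha> + 1) j k * raised (\<alpha> - 1) j k"
    if "1 \<le> \<alpha>" "\<alpha> \<le> r" for \<alpha> j k
    using relation[OF that, of j "k + 1"] by (simp add: raised_def)
qed (use r_pos nonzero boundary in \<open>auto simp: raised_def\<close>)

section \<open>Entries of the intertwining matrix and their identities\<close>

text \<open>
  The entries of the intertwining matrix: \<open>ca m\<close> and \<open>cb m\<close> make up row \<open>m + 1\<close>, and \<open>cc m\<close> and
  \<open>- cb m\<close> make up row \<open>m'\<close>.
\<close>

definition ca :: "nat \<Rightarrow> int \<Rightarrow> 'a" where
  "ca m s = T (m + 1) s 1 * T (m - 1) s 1 / (T m s 2 * T m s 0)"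

definition cb :: "nat \<Rightarrow> int \<Rightarrow> 'a" where
  "cb m s = T (m + 1) s 1 * T m (s - 1) 1 / (T (m + 1) (s - 1) 2 * T m s 0)"

definition cc :: "nat \<Rightarrow> int \<Rightarrow> 'a" where
  "cc m s = T m (s + 1) 1 * T m (s - 1) 1 / (T m s 2 * T m s 0)"

text \<open>This is the T-system relation at level 1, divided by its left-hand side. The identities
  with the weights below need only cancellation of nonzero factors.\<close>

lemma ca_add_cc:
  assumes "1 \<le> m" "m \<le> r"
  shows "ca m s + cc m s = 1"
proof -
  have "T (m + 1) s 1 * T (m - 1) s 1 + T m (s + 1) 1 * T m (s - 1) 1 = T m s 2 * T m s 0"
    using relation[OF assms, of s 1] by simp
  moreover have "T m s 2 * T m s 0 \<noteq> 0"
    using assms nonzero by simp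
  ultimately show ?thesis
    unfolding ca_def cc_def by (simp flip: add_divide_distrib)
qed

text \<open>Lets the end vertex r+2 obey the same formula as the side vertices.\<close>

lemma cc_last: "cc (r + 1) s = 1"
  using boundary by (simp add: cc_def)

lemma y_1: "y U 1 s = U 1 s 1 / U 1 (s + 1) 0"
  by (simp add: y_def)

lemma y_even:
  "y U (2 * m) s = U (m + 1) s 1 * U (m - 1) (s + 1) 0 / (U m s 0 * U m (s + 1) 1)"
proof -
  have "2 * m \<noteq> 1" by presburger
  then show ?thesis by (simp add: y_def)
qed

lemma y_odd:
  "1 \<le> m \<Longrightarrow> y U (2 * m + 1) s =
    U (m + 1) (s - 1) 1 * U m (s + 1) 0 / (U (m + 1) s 0 * U m s 1)"
  by (simp add: y_def)

text \<open>The return from (m+1)' to m+1 thus contributes \<open>cc m s\<close>, which completes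
  \<open>ca m s\<close> to 1 in row m+1 and cancels in row m'.\<close>

lemma cb_mult_y_raised:
  assumes "1 \<le> m" "m \<le> r"
  shows "cb m s * y raised (2 * m + 1) s = cc m s"
  using assms nonzero unfolding y_odd[OF assms(1)] by (simp add: cb_def cc_def raised_def divide_simps)

text \<open>Together with \<open>y_mult_ca\<close>: the step from m+2 down to m+1 followed by row
  m+1 of A(s+1) is \<open>ca (m + 1) s\<close> times the steps of M'(s) from m+1 to m and to (m+1)'.
  The pair \<open>y_odd_mult_cb\<close>, \<open>y_odd_mult_ca\<close> is the analogue for the step
  from (m+1)', with \<open>cc (m + 1) s\<close>.\<close>

lemma y_mult_cb:
  assumes "1 \<le> m" "m < r"
  shows "y T (2 * (m + 1)) s * cb m (s + 1) = ca (m + 1) s"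
  using assms nonzero unfolding y_even by (simp add: cb_def ca_def divide_simps)

lemma y_mult_ca:
  assumes "1 \<le> m" "m < r"
  shows "y T (2 * (m + 1)) s * ca m (s + 1) = ca (m + 1) s * y raised (2 * m) s"
  using assms nonzero unfolding y_even by (simp add: ca_def raised_def divide_simps)

lemma y_odd_mult_cb:
  assumes "1 \<le> m" "m \<le> r"
  shows "y T (2 * m + 1) s * cb m (s + 1) = cc (m + 1) s"
  using assms nonzero unfolding y_odd[OF assms(1)] by (simp add: cb_def cc_def divide_simps)

lemma y_odd_mult_ca:
  assumes "1 \<le> m" "m \<le> r"
  shows "y T (2 * m + 1) s * ca m (s + 1) = cc (m + 1) s * y raised (2 * m) s"
  using assms nonzero unfolding y_odd[OF assms(1)] y_even by (simp add: ca_def cc_def raised_def divide_simps)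

section \<open>Propagation of the relation backwards in time\<close>

text \<open>\<open>intertwined s f g\<close> says that \<open>f = A(s) g\<close> for column vectors \<open>f\<close>, \<open>g\<close> indexed by the vertices.\<close>

definition intertwined :: "int \<Rightarrow> (vertex \<Rightarrow> 'a) \<Rightarrow> (vertex \<Rightarrow> 'a) \<Rightarrow> bool" where
  "intertwined s f g \<longleftrightarrow>
     f (Spine 0) = T 1 (s + 1) 1 / T 1 s 2 * g (Spine 1) - T 2 s 1 / T 2 (s - 1) 2 * g (side r 2) \<and>
     f (Spine 1) = g (Spine 0) \<and>
     (\<forall>m\<in>{1..r}. f (Spine (m + 1)) = ca m s * g (Spine m) + cb m s * g (side r (m + 1))) \<and>
     (\<forall>m\<in>{2..r}. f (side r m) = cc m s * g (Spine m) - cb m s * g (side r (m + 1))) \<and>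
     f (side r (r + 1)) = g (Spine (r + 1))"

text \<open>The two rows have opposite \<open>cb\<close> entries, and \<open>ca_add_cc\<close>
  collapses the rest.\<close>

lemma intertwined_side:
  assumes "intertwined s f g" "1 \<le> m" "m < r"
  shows "f (Spine (m + 2)) + f (side r (m + 1)) = g (Spine (m + 1))"
proof -
  have "m + 1 \<in> {1..r}" "m + 1 \<in> {2..r}" using assms by auto
  then have "f (Spine (m + 2)) + f (side r (m + 1)) =
      (ca (m + 1) s + cc (m + 1) s) * g (Spine (m + 1))"
    using assms(1) by (simp add: intertwined_def algebra_simps)
  then show ?thesis
    using ca_add_cc[of "m + 1" s] assms by simp
qed

text \<open>In one step, 0 is reached only from 1, with weight y_1(t). The right-hand vector is
  y_1(t) e_0, and column 0 of A(t) turns it into y_1(t) e_1.\<close>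

lemma intertwined_end:
  "intertwined t (\<lambda>v. Z r T t (t + 1) v (Spine 0))
     (\<lambda>v. y T 1 t * Z r raised t t v (Spine 0))"
proof -
  have Z_spine: "Z r U u u (Spine m) (Spine 0) = (if m = 0 then 1 else 0)"
    if "m \<le> r + 2" for U :: "nat \<Rightarrow> int \<Rightarrow> int \<Rightarrow> 'a" and u m
    using that by (subst Z_same) (auto simp: G_verts_def)
  have Z_side: "Z r U u u (side r (m + 1)) (Spine 0) = 0"
    if "1 \<le> m" "m \<le> r" for U :: "nat \<Rightarrow> int \<Rightarrow> int \<Rightarrow> 'a" and u m
    using that by (subst Z_same) (auto simp: G_verts_def side_def)
  show ?thesis
    unfolding intertwined_def
  proof (intro conjI ballI)
    show "Z r T t (t + 1) (Spine 0) (Spine 0) =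
        T 1 (t + 1) 1 / T 1 t 2 * (y T 1 t * Z r raised t t (Spine 1) (Spine 0)) -
        T 2 t 1 / T 2 (t - 1) 2 * (y T 1 t * Z r raised t t (side r 2) (Spine 0))"
      using r_pos Z_side[of 1] by (simp add: Z_step(1) Z_spine numeral_2_eq_2)
    show "Z r T t (t + 1) (Spine 1) (Spine 0) = y T 1 t * Z r raised t t (Spine 0) (Spine 0)"
      using r_pos Z_step(2)[of t "t + 1" r T "Spine 0"] by (simp add: Z_spine)
    show "Z r T t (t + 1) (Spine (m + 1)) (Spine 0) =
        ca m t * (y T 1 t * Z r raised t t (Spine m) (Spine 0)) +
        cb m t * (y T 1 t * Z r raised t t (side r (m + 1)) (Spine 0))" if "m \<in> {1..r}" for m
    proof (cases "m = r")
      case True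
      then show ?thesis
        using r_pos Z_step(4)[of t "t + 1" r T "Spine 0"] Z_side[of r] by (simp add: Z_spine)
    next
      case False
      then show ?thesis
        using r_pos that Z_step(3)[of t "t + 1" r m T "Spine 0"] Z_side[of m]
        by (simp add: Z_spine)
    qed
    have side_0: "Z r T t (t + 1) (side r m) (Spine 0) = 0" if "2 \<le> m" "m \<le> r + 1" for m
    proof -
      define l where "l = m - 1"
      have "m = l + 1" "1 \<le> l" "l \<le> r" using that by (auto simp: l_def)
      then show ?thesis
        using r_pos Z_step(5)[of t "t + 1" r l T "Spine 0"] by (simp add: Z_spine)
    qed
    show "Z r T t (t + 1) (side r m) (Spine 0) =
        cc m t * (y T 1 t * Z r raised t t (Spine m) (Spine 0)) -
        cb m t * (y T 1 t * Z r raised t t (side r (m + 1)) (Spine 0))" if "m \<in> {2..r}" for m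
      using that side_0[of m] Z_side[of m] by (simp add: Z_spine)
    show "Z r T t (t + 1) (side r (r + 1)) (Spine 0) =
        y T 1 t * Z r raised t t (Spine (r + 1)) (Spine 0)"
      using side_0[of "r + 1"] r_pos by (simp add: Z_spine)
  qed
qed

text \<open>Row by row, M(s) A(s+1) = A(s) M'(s) is checked on the vector \<open>g\<close> at time
  s+1; the scalar \<open>w\<close> passes through by linearity.\<close>

lemma intertwined_step:
  assumes "s < t"
    and IH: "intertwined (s + 1) (\<lambda>v. Z r T (s + 1) (t + 1) v b) (\<lambda>v. w * Z r raised (s + 1) t v b')"
  shows "intertwined s (\<lambda>v. Z r T s (t + 1) v b) (\<lambda>v. w * Z r raised s t v b')"
proof -
  define f where "f v = Z r T (s + 1) (t + 1) v b" for v
  define g where "g v = w * Z r raised (s + 1) t v b'" for v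
  define f' where "f' v = Z r T s (t + 1) v b" for v
  define g' where "g' v = w * Z r raised s t v b'" for v
  have st: "s < t + 1" using assms(1) by simp
  note f_step = Z_step[where T = T and b = b, OF st r_pos, folded f_def f'_def]
  have g_step:
    "g' (Spine 0) = g (Spine 1)"
    "g' (Spine 1) = g (Spine 2) + y raised 1 s * g (Spine 0)"
    "1 \<le> m \<Longrightarrow> m < r \<Longrightarrow> g' (Spine (m + 1)) =
      g (Spine (m + 2)) + g (side r (m + 1)) + y raised (2 * m) s * g (Spine m)"
    "g' (Spine (r + 1)) = g (side r (r + 1)) + y raised (2 * r) s * g (Spine r)"
    "1 \<le> m \<Longrightarrow> m \<le> r \<Longrightarrow> g' (side r (m + 1)) = y raised (2 * m + 1) s * g (Spine (m + 1))" for m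
    unfolding g_def g'_def Z_step[OF assms(1) r_pos] by (simp_all add: algebra_simps Z_step[OF assms(1) r_pos])
  have I: "intertwined (s + 1) f g"
    using IH by (simp add: f_def[abs_def] g_def[abs_def])
  have I0: "f (Spine 0) = T 1 (s + 2) 1 / T 1 (s + 1) 2 * g (Spine 1) -
      T 2 (s + 1) 1 / T 2 s 2 * g (side r 2)"
    and I1: "f (Spine 1) = g (Spine 0)"
    and I_last: "f (side r (r + 1)) = g (Spine (r + 1))"
    using I by (simp_all add: intertwined_def add.assoc)
  have I_spine: "f (Spine (m + 1)) = ca m (s + 1) * g (Spine m) + cb m (s + 1) * g (side r (m + 1))"
    if "1 \<le> m" "m \<le> r" for m
    using I that by (simp add: intertwined_def)
  \<comment> \<open>The case \<open>m = r\<close> is the end vertex r+2, so this serves the last row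
    as well as the rows of the side vertices.\<close>
  have down: "f' (side r (m + 1)) =
      cc (m + 1) s * (g (side r (m + 1)) + y raised (2 * m) s * g (Spine m))"
    if "1 \<le> m" "m \<le> r" for m
  proof -
    have "f' (side r (m + 1)) = y T (2 * m + 1) s * ca m (s + 1) * g (Spine m) +
        y T (2 * m + 1) s * cb m (s + 1) * g (side r (m + 1))"
      unfolding f_step(5)[OF that] I_spine[OF that] by (simp add: distrib_left)
    then show ?thesis
      unfolding y_odd_mult_cb[OF that] y_odd_mult_ca[OF that] by (simp add: algebra_simps)
  qed
  have nz: "T 1 j k \<noteq> 0" "T 2 j k \<noteq> 0" for j k
    using nonzero r_pos by simp_all
  have "intertwined s f' g'"
    unfolding intertwined_def
  proof (intro conjI ballI)
    \<comment> \<open>The entries of row 0 are fixed by two demands: \<open>g (Spine 0)\<close> gets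
      coefficient 1, and the two contributions of \<open>g (Spine 2)\<close> cancel.\<close>
    have "T 1 (s + 1) 1 / T 1 s 2 * y raised 1 s = 1"
      using nz unfolding y_1 by (simp add: raised_def)
    moreover have "T 2 s 1 / T 2 (s - 1) 2 * y raised 3 s = T 1 (s + 1) 1 / T 1 s 2"
      using nz y_odd[of 1 raised s, simplified, folded numeral_2_eq_2] by (simp add: raised_def)
    moreover have "g' (side r 2) = y raised 3 s * g (Spine 2)"
      using g_step(5)[of 1] r_pos by (simp flip: numeral_2_eq_2)
    moreover have "f' (Spine 0) = g (Spine 0)"
      using f_step(1) I1 by simp
    ultimately show "f' (Spine 0) =
        T 1 (s + 1) 1 / T 1 s 2 * g' (Spine 1) - T 2 s 1 / T 2 (s - 1) 2 * g' (side r 2)"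
      unfolding g_step(2) by (simp add: distrib_left flip: mult.assoc)
  next
    \<comment> \<open>Scaled by y_1(s), row 0 of A(s+1) has the form of a row 1': the vertex 0
      replaces the missing side vertex of 1, and the cancellation of \<open>intertwined_side\<close>
      recurs.\<close>
    have e1: "y T 1 s * (T 1 (s + 2) 1 / T 1 (s + 1) 2) = cc 1 (s + 1)"
      unfolding y_1 by (simp add: cc_def mult.commute add.commute)
    have e2: "y T 1 s * (T 2 (s + 1) 1 / T 2 s 2) = cb 1 (s + 1)"
      unfolding y_1 by (simp add: cb_def mult.commute numeral_2_eq_2)
    have e3: "f' (Spine 1) = ca 1 (s + 1) * g (Spine 1) + cb 1 (s + 1) * g (side r 2) +
        y T 1 s * f (Spine 0)"
      using f_step(2) I_spine[of 1] r_pos by (simp add: numeral_2_eq_2)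
    have "f' (Spine 1) = (ca 1 (s + 1) + cc 1 (s + 1)) * g (Spine 1)"
      unfolding e3 I0 e1[symmetric] e2[symmetric] by (simp add: algebra_simps)
    then show "f' (Spine 1) = g' (Spine 0)"
      using g_step(1) ca_add_cc[of 1] r_pos by simp
  next
    fix m assume m: "m \<in> {1..r}"
    \<comment> \<open>The steps upwards and sideways merge into one term; at \<open>m = r\<close>
      only the step to r+2 is present.\<close>
    have up: "f' (Spine (m + 1)) = g (Spine (m + 1)) + y T (2 * m) s * f (Spine m)"
    proof (cases "m = r")
      case True
      then show ?thesis using f_step(4) I_last by simp
    next
      case False
      then show ?thesis using f_step(3)[of m] intertwined_side[OF I, of m] m by simp
    qed
    have cb: "cb m s * g' (side r (m + 1)) = cc m s * g (Spine (m + 1))"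
      using g_step(5)[of m] cb_mult_y_raised[of m s] m by (simp flip: mult.assoc)
    \<comment> \<open>The added term is the step up contained in \<open>g' (Spine m)\<close>; the
      other steps remain to be compared. Row 1 of A(s+1) is e_0, so \<open>m = 1\<close> is
      separate.\<close>
    have cases: "y T (2 * m) s * f (Spine m) + ca m s * g (Spine (m + 1)) = ca m s * g' (Spine m)"
    proof (cases m)
      case 0
      then show ?thesis using m by simp
    next
      case (Suc l)
      show ?thesis
      proof (cases "l = 0")
        case True
        have "y T 2 s = ca 1 s * y raised 1 s"
          using nz boundary y_even[of T 1 s] y_1[of raised s] by (simp add: ca_def raised_def numeral_2_eq_2)
        then show ?thesis
          using Suc True I1 g_step(2) by (simp add: algebra_simps numeral_2_eq_2)
      next
        case False
        then have l: "1 \<le> l" "l < r" using Suc m by auto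
        have "y T (2 * m) s * f (Spine m) =
            y T (2 * (l + 1)) s * ca l (s + 1) * g (Spine l) +
            y T (2 * (l + 1)) s * cb l (s + 1) * g (side r (l + 1))"
          using I_spine[of l] l Suc by (simp add: distrib_left)
        also have "\<dots> = ca m s * (y raised (2 * l) s * g (Spine l) + g (side r (l + 1)))"
          unfolding y_mult_cb[OF l] y_mult_ca[OF l] using Suc by (simp add: algebra_simps)
        finally show ?thesis
          using g_step(3)[OF l] Suc by (simp add: algebra_simps)
      qed
    qed
    \<comment> \<open>The coefficient 1 is split: \<open>ca\<close> belongs to the step up from m,
      \<open>cc\<close> to the return from (m+1)'.\<close>
    have "f' (Spine (m + 1)) = (ca m s + cc m s) * g (Spine (m + 1)) + y T (2 * m) s * f (Spine m)"
      using up ca_add_cc[of m s] m by simp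
    then show "f' (Spine (m + 1)) = ca m s * g' (Spine m) + cb m s * g' (side r (m + 1))"
      unfolding cb cases[symmetric] by (simp add: algebra_simps)
  next
    fix m assume m: "m \<in> {2..r}"
    define l where "l = m - 1"
    have l: "m = l + 1" "1 \<le> l" "l < r"
      using m by (auto simp: l_def)
    have cb: "cb m s * g' (side r (m + 1)) = cc m s * g (Spine (m + 1))"
      using g_step(5)[of m] cb_mult_y_raised[of m s] l by (simp flip: mult.assoc)
    \<comment> \<open>The step up from m and the return from (m+1)' both yield
      \<open>cc m s * g (Spine (m + 1))\<close> and cancel.\<close>
    show "f' (side r m) = cc m s * g' (Spine m) - cb m s * g' (side r (m + 1))"
      unfolding cb using down[of l] g_step(3)[of l] l by (simp add: algebra_simps)
  next
    show "f' (side r (r + 1)) = g' (Spine (r + 1))"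
      using down[of r] g_step(4) r_pos cc_last[of s] by simp
  qed
  then show ?thesis by (simp add: f'_def[abs_def] g'_def[abs_def])
qed

lemma intertwined_Z:
  assumes "s \<le> t"
  shows "intertwined s (\<lambda>v. Z r T s (t + 1) v (Spine 0)) (\<lambda>v. y T 1 t * Z r raised s t v (Spine 0))"
  using assms
proof (induction s rule: int_le_induct)
  case base
  show ?case by (rule intertwined_end)
next
  case (step s)
  then show ?case using intertwined_step[of "s - 1" t] by simp
qed

text \<open>The first step from 0 is forced and has weight 1; row 1 of the intertwining relation
  then replaces start 1 by start 0.\<close>

lemma Z_raise:
  assumes "s \<le> t"
  shows "Z r T (s - 1) (t + 1) (Spine 0) (Spine 0) = y T 1 t * Z r raised s t (Spine 0) (Spine 0)"
proof -
  have "Z r T (s - 1) (t + 1) (Spine 0) (Spine 0) = Z r T s (t + 1) (Spine 1) (Spine 0)"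
    using Z_step(1)[of "s - 1" "t + 1" r T "Spine 0"] assms r_pos by simp
  then show ?thesis
    using intertwined_Z[of s t] assms by (simp add: intertwined_def)
qed

end

section \<open>Induction on the level\<close>

lemma T_family_partition_function:
  assumes "T_family r T"
  shows "T 1 j (int n) = T 1 (j + int n) 0 * Z r T (j - int n) (j + int n) (Spine 0) (Spine 0)"
  using assms
\<comment> \<open>The induction hypothesis is applied to \<open>raised\<close>, so the family must
  vary.\<close>
proof (induction n arbitrary: T)
  case 0
  then show ?case by (simp add: Z_same G_verts_def)
next
  case (Suc n)
  interpret T_family r T by fact
  have "T 1 j (int (Suc n)) = raised 1 j (int n)"
    by (simp add: raised_def add.commute)
  also have "\<dots> = raised 1 (j + int n) 0 *
      Z r raised (j - int n) (j + int n) (Spine 0) (Spine 0)"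
    by (rule Suc.IH[OF raised_family])
  also have "raised 1 (j + int n) 0 = T 1 (j + int n + 1) 0 * y T 1 (j + int n)"
    using nonzero[of 1] by (simp only: raised_def y_1) simp
  finally show ?case
    using Z_raise[of "j - int n" "j + int n"] by (simp add: algebra_simps)
qed

theorem theorem5p5:
  fixes r :: nat and T :: "nat \<Rightarrow> int \<Rightarrow> int \<Rightarrow> 'k::field_char_0 ratfun" and j k :: int
  assumes "r \<ge> 1" and "T_system r T" and "k \<ge> 0"
  shows "T 1 j k = T 1 (j + k) 0 * Z r T (j - k) (j + k) (Spine 0) (Spine 0)"
proof -
  have "T_family r T"
    using assms(1,2) by unfold_locales (auto simp: T_system_def)
  then show ?thesis
    using T_family_partition_function[of r T j "nat k"] assms(3) by simp
qed

end
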